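(* Let $H>0$ and let $X=\{X(t),\,t\in\mathbb R_+\}$ be a real-valued $H$-SSSI process. If there is a constant $p>\max\{1,1/H\}$ such that $\mathbb E(|X(1)|^p)<\infty$, then for every $\varepsilon>0$, $$\lim_{t\to\infty}\frac{|X(t)|}{t^H(\log t)^{\frac1p+\varepsilon}}=0\quad\text{almost surely.}$$
   Context: $\mathbb R_+=[0,\infty)$. A real-valued stochastic process $X=\{X(t),t\in\mathbb R_+\}$ is self-similar with index $H>0$ if for all constants $c>0$, $\{X(ct),t\in\mathbb R_+\}\stackrel{d}{=}\{c^HX(t),t\in\mathbb R_+\}$, where $\stackrel{d}{=}$ means equality of all finite-dimensional distributions. $X$ has stationary increments if for every $t_0\in\mathbb R_+$, $\{X(t_0+t)-X(t_0),t\in\mathbb R_+\}\stackrel{d}{=}\{X(t)-X(0),t\in\mathbb R_+\}$. $X$ is called $H$-SSSI if it is self-similar with index $H$ and has stationary increments. The limit is as the continuous parameter $t$ tends to infinity.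
   Formalization: For an arbitrary version of X the limit can fail (add spikes at random times U+n); it is proved for X if X is separable in Doob's sense (e.g. has continuous paths), and for every X it is proved for some modification of X with continuous paths. *)

theory Defs
  imports "HOL-Probability.Probability"
begin

text \<open>
  A process indexed by the half line is a function on all reals of which only the
  values at times \<open>t \<ge> 0\<close> are ever looked at.
\<close>

definition real_process :: "'a measure \<Rightarrow> (real \<Rightarrow> 'a \<Rightarrow> real) \<Rightarrow> bool" where
  "real_process M X \<longleftrightarrow> (\<forall>t\<ge>0. X t \<in> borel_measurable M)"

text \<open>
  Equality of the joint laws over every finite set of times; measurability of the
  processes, needed for \<^const>\<open>distr\<close> to be meaningful, is supplied by \<open>real_process\<close>.
\<close>

definition fdd_eq ::
  "'a measure \<Rightarrow> (real \<Rightarrow> 'a \<Rightarrow> real) \<Rightarrow> (real \<Rightarrow> 'a \<Rightarrow> real) \<Rightarrow> bool" where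
  "fdd_eq M Y Z \<longleftrightarrow>
     (\<forall>J. finite J \<and> J \<subseteq> {0..} \<longrightarrow>
        distr M (Pi\<^sub>M J (\<lambda>_. borel)) (\<lambda>\<omega>. \<lambda>t\<in>J. Y t \<omega>) =
        distr M (Pi\<^sub>M J (\<lambda>_. borel)) (\<lambda>\<omega>. \<lambda>t\<in>J. Z t \<omega>))"

definition self_similar :: "'a measure \<Rightarrow> real \<Rightarrow> (real \<Rightarrow> 'a \<Rightarrow> real) \<Rightarrow> bool" where
  "self_similar M H X \<longleftrightarrow>
     (\<forall>c>0. fdd_eq M (\<lambda>t \<omega>. X (c * t) \<omega>) (\<lambda>t \<omega>. c powr H * X t \<omega>))"

definition stationary_increments :: "'a measure \<Rightarrow> (real \<Rightarrow> 'a \<Rightarrow> real) \<Rightarrow> bool" where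
  "stationary_increments M X \<longleftrightarrow>
     (\<forall>t0\<ge>0. fdd_eq M (\<lambda>t \<omega>. X (t0 + t) \<omega> - X t0 \<omega>) (\<lambda>t \<omega>. X t \<omega> - X 0 \<omega>))"

definition SSSI :: "'a measure \<Rightarrow> real \<Rightarrow> (real \<Rightarrow> 'a \<Rightarrow> real) \<Rightarrow> bool" where
  "SSSI M H X \<longleftrightarrow>
     real_process M X \<and> self_similar M H X \<and> stationary_increments M X"

text \<open>
  The finite-dimensional distributions do not determine whether a limit along a
  continuous parameter exists: adding to a process a spike at each time \<open>U + n\<close>, where
  \<open>U\<close> is an independent uniform random variable, leaves them unchanged. Almost sure
  path statements are therefore understood for separable processes in the sense
  of Doob, or for a suitable modification.

  In the definition of separability, almost every path has its graph in the closure of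
  its graph over \<open>D\<close>, that is, each \<open>t \<ge> 0\<close> is the limit of some \<open>s\<^sub>n \<in> D\<close> with
  \<open>X(s\<^sub>n) \<longlonglongrightarrow> X(t)\<close>. In particular \<open>D\<close> is dense in the half line. Every process with
  almost surely continuous, or right-continuous, paths is separable.
\<close>

definition separable_process :: "'a measure \<Rightarrow> (real \<Rightarrow> 'a \<Rightarrow> real) \<Rightarrow> bool" where
  "separable_process M X \<longleftrightarrow>
     (\<exists>D. countable D \<and> D \<subseteq> {0..} \<and>
        (AE \<omega> in M. \<forall>t\<ge>0. (t, X t \<omega>) \<in> closure ((\<lambda>s. (s, X s \<omega>)) ` D)))"

definition is_modification ::
  "'a measure \<Rightarrow> (real \<Rightarrow> 'a \<Rightarrow> real) \<Rightarrow> (real \<Rightarrow> 'a \<Rightarrow> real) \<Rightarrow> bool" where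
  "is_modification M X Y \<longleftrightarrow>
     real_process M Y \<and> (\<forall>t\<ge>0. AE \<omega> in M. Y t \<omega> = X t \<omega>)"

definition continuous_paths :: "'a measure \<Rightarrow> (real \<Rightarrow> 'a \<Rightarrow> real) \<Rightarrow> bool" where
  "continuous_paths M X \<longleftrightarrow> (\<forall>\<omega>\<in>space M. continuous_on {0..} (\<lambda>t. X t \<omega>))"

end

theory Submission
  imports Defs "HOL-Real_Asymp.Real_Asymp"
begin

text \<open>
  Self-similarity and stationarity of the increments give \<open>X(t) - X(s) = (t - s)\<^sup>H X(1)\<close> in law,
  so by Markov's inequality \<open>\<bar>X(t) - X(s)\<bar> \<ge> a\<close> has probability at most
  \<open>K ((t - s)\<^sup>H / a)\<^sup>p\<close>, where \<open>K = E \<bar>X(1)\<bar>\<^sup>p\<close>. Apply this to all \<open>2\<^sup>k\<close> increments of \<open>X\<close> over the level \<open>k\<close>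
  dyadic subdivision of \<open>[0, 2\<^sup>n]\<close>, with threshold \<open>a = B q\<^sup>k\<close>.
  Since \<open>H p > 1\<close>, some \<open>q < 1\<close> makes the
  resulting probabilities decay geometrically in \<open>k\<close>. For fixed \<open>n\<close>, Borel--Cantelli in \<open>k\<close> gives
  uniform continuity on the dyadics in \<open>[0, 2\<^sup>n]\<close>, hence a continuous modification. With
  \<open>B = n\<^bsup>1/p + \<epsilon>\<^esup> 2\<^bsup>nH\<^esup>\<close> the sum over all \<open>k\<close> is \<open>O(n\<^bsup>-1 - \<epsilon>p\<^esup>)\<close>, so Borel--Cantelli in \<open>n\<close> and
  chaining bound \<open>X\<close> on \<open>[0, 2\<^sup>n]\<close> by a multiple of \<open>B\<close>. A separable \<open>X\<close> agrees almost surely with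
  the continuous modification at all times, because the latter has a closed graph.
\<close>

section \<open>Deterministic chaining over dyadic subdivisions\<close>

text \<open>Replacing \<open>j\<close> by \<open>j div 2\<close> goes one level down and costs
  nothing for even \<open>j\<close>, one increment of the finer level for odd \<open>j\<close>. The
  right-hand side is the sum of \<open>B * q ^ k\<close> over \<open>m < k \<le> m + l\<close> in
  closed form.\<close>

lemma dyadic_chain:
  fixes f :: "real \<Rightarrow> real"
  assumes q: "0 \<le> q" "q < 1"
    and step: "\<And>k j. k0 \<le> k \<Longrightarrow> j < 2 ^ k \<Longrightarrow>
      \<bar>f (real (Suc j) * T / 2 ^ k) - f (real j * T / 2 ^ k)\<bar> \<le> B * q ^ k"
    and "k0 \<le> m" "B \<ge> 0"
  shows "j \<le> 2 ^ (m + l) \<Longrightarrow>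
    \<bar>f (real j * T / 2 ^ (m + l)) - f (real (j div 2 ^ l) * T / 2 ^ m)\<bar>
      \<le> B * ((q ^ m - q ^ (m + l)) * q / (1 - q))"
proof (induction l arbitrary: j)
  case 0
  then show ?case by simp
next
  case (Suc l)
  define i where "i = j div 2"
  have "i \<le> 2 ^ (m + l)" using Suc.prems by (simp add: i_def)
  note IH = Suc.IH[OF this]
  have div: "i div 2 ^ l = j div 2 ^ Suc l" by (simp add: i_def div_mult2_eq)
  have half: "real (2 * i) * T / 2 ^ (m + Suc l) = real i * T / 2 ^ (m + l)" by simp
  have "\<bar>f (real j * T / 2 ^ (m + Suc l)) - f (real i * T / 2 ^ (m + l))\<bar> \<le> B * q ^ (m + Suc l)"
  proof (cases "even j")
    case True
    then have "j = 2 * i" by (simp add: i_def)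
    then show ?thesis unfolding half[symmetric] using q \<open>B \<ge> 0\<close> by simp
  next
    case False
    then have j: "j = Suc (2 * i)" by (simp add: i_def)
    then show ?thesis unfolding half[symmetric]
      using step[of "m + Suc l" "2 * i"] Suc.prems \<open>k0 \<le> m\<close> by simp
  qed
  then have "\<bar>f (real j * T / 2 ^ (m + Suc l)) - f (real (j div 2 ^ Suc l) * T / 2 ^ m)\<bar>
    \<le> B * q ^ (m + Suc l) + B * ((q ^ m - q ^ (m + l)) * q / (1 - q))"
    using IH unfolding div by linarith
  also have "\<dots> = B * ((q ^ m - q ^ (m + Suc l)) * q / (1 - q))"
    using q by (simp add: field_simps)
  finally show ?case .
qed

text \<open>The finite geometric sum is replaced by a bound free of \<open>l\<close>, since the
  level of a dyadic point can be arbitrarily high.\<close>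

lemma dyadic_chain_uniform:
  fixes f :: "real \<Rightarrow> real"
  assumes q: "0 \<le> q" "q < 1"
    and step: "\<And>k j. k0 \<le> k \<Longrightarrow> j < 2 ^ k \<Longrightarrow>
      \<bar>f (real (Suc j) * T / 2 ^ k) - f (real j * T / 2 ^ k)\<bar> \<le> B * q ^ k"
    and "k0 \<le> m" "B \<ge> 0" "j \<le> 2 ^ (m + l)"
  shows "\<bar>f (real j * T / 2 ^ (m + l)) - f (real (j div 2 ^ l) * T / 2 ^ m)\<bar>
      \<le> B * q ^ m / (1 - q)"
proof -
  have "(q ^ m - q ^ (m + l)) * q \<le> q ^ m * 1"
    by (intro mult_mono) (use q in auto)
  then have "B * ((q ^ m - q ^ (m + l)) * q / (1 - q)) \<le> B * (q ^ m * 1 / (1 - q))"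
    using q \<open>B \<ge> 0\<close> by (intro mult_left_mono divide_right_mono) auto
  then show ?thesis
    using dyadic_chain[of q k0 f T B m j l, OF q step] assms(4-6) by simp
qed

text \<open>Two points less than one level \<open>m\<close> mesh apart have level \<open>m\<close>
  ancestors \<open>a\<close>, \<open>b\<close> that are equal or adjacent. Two chains and at most
  one increment of level \<open>m\<close> join the points, whence the factor 3.\<close>

lemma dyadic_modulus:
  fixes f :: "real \<Rightarrow> real"
  assumes q: "0 \<le> q" "q < 1"
    and step: "\<And>k j. k0 \<le> k \<Longrightarrow> j < 2 ^ k \<Longrightarrow>
      \<bar>f (real (Suc j) * T / 2 ^ k) - f (real j * T / 2 ^ k)\<bar> \<le> B * q ^ k"
    and m: "k0 \<le> m" and B: "B \<ge> 0" and j: "i \<le> j" "j \<le> 2 ^ (m + l)" "j < i + 2 ^ l"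
  shows "\<bar>f (real j * T / 2 ^ (m + l)) - f (real i * T / 2 ^ (m + l))\<bar> \<le> 3 * (B * q ^ m / (1 - q))"
proof -
  define a where "a = i div 2 ^ l"
  define b where "b = j div 2 ^ l"
  have "b \<le> (i + 2 ^ l) div 2 ^ l" unfolding b_def using j by (intro div_le_mono) auto
  then have "b \<le> Suc a" by (simp add: a_def)
  moreover have "a \<le> b" unfolding a_def b_def using j by (intro div_le_mono)
  ultimately consider "b = a" | "b = Suc a" by linarith
  then have "\<bar>f (real b * T / 2 ^ m) - f (real a * T / 2 ^ m)\<bar> \<le> B * q ^ m"
  proof cases
    case 2
    have "b \<le> 2 ^ (m + l) div 2 ^ l" unfolding b_def using j by (intro div_le_mono)
    then have "b \<le> 2 ^ m" by (simp add: power_add)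
    with 2 show ?thesis using step[OF m, of a] by simp
  qed (use B q in auto)
  also have "\<dots> \<le> B * q ^ m / (1 - q)"
    using q B mult_left_le[of q "B * q ^ m"] by (simp add: field_simps)
  finally have 1: "\<bar>f (real b * T / 2 ^ m) - f (real a * T / 2 ^ m)\<bar> \<le> B * q ^ m / (1 - q)" .
  have "\<bar>f (real j * T / 2 ^ (m + l)) - f (real b * T / 2 ^ m)\<bar> \<le> B * q ^ m / (1 - q)"
    unfolding b_def by (rule dyadic_chain_uniform[OF q step m B]) (use j in auto)
  moreover have "\<bar>f (real i * T / 2 ^ (m + l)) - f (real a * T / 2 ^ m)\<bar> \<le> B * q ^ m / (1 - q)"
    unfolding a_def by (rule dyadic_chain_uniform[OF q step m B]) (use j in auto)
  ultimately show ?thesis using 1 by linarith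
qed

section \<open>Continuity and growth on the dyadic numbers\<close>

definition dyadics :: "real set" where
  "dyadics = {real j / 2 ^ m |j m. True}"

text \<open>Every sufficiently fine level is offered, not just one, so that two dyadic numbers can
  be placed on a common level of the subdivision of [0, 2^n].\<close>

lemma dyadic_level:
  assumes "d \<in> dyadics"
  obtains L where "\<And>l. l \<ge> L \<Longrightarrow> \<exists>j. d = real j * 2 ^ n / 2 ^ l"
proof -
  obtain j m where d: "d = real j / 2 ^ m" using assms by (auto simp: dyadics_def)
  have "d = real (j * 2 ^ (l - (m + n))) * 2 ^ n / 2 ^ l" if "l \<ge> m + n" for l
  proof -
    have "(2::real) ^ l = 2 ^ (l - (m + n)) * 2 ^ m * 2 ^ n"
      using that by (simp flip: power_add)
    then show ?thesis by (simp add: d)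
  qed
  then show ?thesis using that[of "m + n"] by blast
qed

text \<open>Control from some level \<open>k0\<close> on is what Borel--Cantelli along the levels
  supplies. The mesh of a level \<open>m\<close> whose chaining bound is below \<open>e\<close>
  serves as the modulus.\<close>

lemma dyadic_uniformly_continuous:
  fixes f :: "real \<Rightarrow> real"
  assumes q: "0 \<le> q" "q < 1"
    and step: "\<And>k j. k0 \<le> k \<Longrightarrow> j < 2 ^ k \<Longrightarrow>
      \<bar>f (real (Suc j) * 2 ^ n / 2 ^ k) - f (real j * 2 ^ n / 2 ^ k)\<bar> \<le> B * q ^ k"
    and B: "B \<ge> 0"
  shows "uniformly_continuous_on (dyadics \<inter> {0..2 ^ n}) f"
  unfolding uniformly_continuous_on_def
proof (intro allI impI)
  fix e :: real assume "e > 0"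
  have "(\<lambda>m. 3 * (B * q ^ m / (1 - q))) \<longlonglongrightarrow> 3 * (B * 0 / (1 - q))"
    using q by (intro tendsto_intros LIMSEQ_power_zero) auto
  then have "\<forall>\<^sub>F m in sequentially. 3 * (B * q ^ m / (1 - q)) < e"
    using \<open>e > 0\<close> by (intro order_tendstoD) auto
  moreover have "\<forall>\<^sub>F m in sequentially. k0 \<le> m" by (rule eventually_ge_at_top)
  ultimately have "\<forall>\<^sub>F m in sequentially. 3 * (B * q ^ m / (1 - q)) < e \<and> k0 \<le> m"
    by eventually_elim auto
  then obtain m where m: "3 * (B * q ^ m / (1 - q)) < e" "k0 \<le> m"
    unfolding eventually_sequentially by blast
  have le: "\<bar>f t - f s\<bar> < e"
    if s: "s \<in> dyadics" and t: "t \<in> dyadics"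
      and st: "s \<le> t" "t \<le> 2 ^ n" "t < s + 2 ^ n / 2 ^ m" for s t
  proof -
    obtain L1 where L1: "\<And>l. l \<ge> L1 \<Longrightarrow> \<exists>j. s = real j * 2 ^ n / 2 ^ l" using dyadic_level[OF s] by metis
    obtain L2 where L2: "\<And>l. l \<ge> L2 \<Longrightarrow> \<exists>j. t = real j * 2 ^ n / 2 ^ l" using dyadic_level[OF t] by metis
    define l where "l = max L1 L2"
    obtain i where i: "s = real i * 2 ^ n / 2 ^ (m + l)" using L1[of "m + l"]
      unfolding l_def by (meson max.cobounded1 trans_le_add2)
    obtain j where j: "t = real j * 2 ^ n / 2 ^ (m + l)" using L2[of "m + l"]
      unfolding l_def by (meson max.cobounded2 trans_le_add2)
    have "i \<le> j" using st(1) by (simp add: i j field_simps)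
    moreover have "real j \<le> 2 ^ (m + l)" using st(2) by (simp add: j field_simps)
    then have "j \<le> 2 ^ (m + l)" by simp
    moreover have "real j * 2 ^ n < real (i + 2 ^ l) * 2 ^ n"
      using st(3) by (simp add: i j field_simps power_add)
    then have "real j < real (i + 2 ^ l)" by (rule mult_right_less_imp_less) simp
    then have "j < i + 2 ^ l" by (simp only: of_nat_less_iff)
    ultimately have "\<bar>f t - f s\<bar> \<le> 3 * (B * q ^ m / (1 - q))"
      unfolding i j using dyadic_modulus[of q k0 f "2 ^ n" B m i j l, OF q step] m B by simp
    with m show ?thesis by simp
  qed
  show "\<exists>d>0. \<forall>x\<in>dyadics \<inter> {0..2 ^ n}. \<forall>x'\<in>dyadics \<inter> {0..2 ^ n}. dist x' x < d \<longrightarrow> dist (f x') (f x) < e"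
  proof (intro exI[of _ "2 ^ n / 2 ^ m"] conjI ballI impI)
    fix x x' :: real
    assume a: "x \<in> dyadics \<inter> {0..2 ^ n}" "x' \<in> dyadics \<inter> {0..2 ^ n}" "dist x' x < 2 ^ n / 2 ^ m"
    then show "dist (f x') (f x) < e"
      using le[of x x'] le[of x' x] by (cases "x \<le> x'") (auto simp: dist_real_def abs_minus_commute)
  qed simp
qed

text \<open>With control from level 0 on, a chain from \<open>d\<close> ends at 0 or at
  \<open>2 ^ n\<close>; in the second case the single increment of level 0 leads on to 0. Each of
  the two pieces costs at most \<open>B / (1 - q)\<close>.\<close>

lemma dyadic_bound:
  fixes f :: "real \<Rightarrow> real"
  assumes q: "0 \<le> q" "q < 1"
    and step: "\<And>k j. j < 2 ^ k \<Longrightarrow>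
      \<bar>f (real (Suc j) * 2 ^ n / 2 ^ k) - f (real j * 2 ^ n / 2 ^ k)\<bar> \<le> B * q ^ k"
    and B: "B \<ge> 0" and d: "d \<in> dyadics" "d \<le> 2 ^ n"
  shows "\<bar>f d - f 0\<bar> \<le> 2 * B / (1 - q)"
proof -
  obtain l where "\<exists>j. d = real j * 2 ^ n / 2 ^ l" using dyadic_level[OF d(1)] by blast
  then obtain j where j: "d = real j * 2 ^ n / 2 ^ l" by blast
  have "real j \<le> 2 ^ l" using d(2) by (simp add: j field_simps)
  then have jl: "j \<le> 2 ^ l" by simp
  have 1: "\<bar>f d - f (real (j div 2 ^ l) * 2 ^ n)\<bar> \<le> B / (1 - q)"
    using dyadic_chain_uniform[of q 0 f "2 ^ n" B 0 j l, OF q step] jl B by (simp add: j)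
  have "j div 2 ^ l \<le> 2 ^ l div 2 ^ l" using jl by (intro div_le_mono)
  then have "j div 2 ^ l = 0 \<or> j div 2 ^ l = 1" by auto
  then have "\<bar>f (real (j div 2 ^ l) * 2 ^ n) - f 0\<bar> \<le> B"
    using step[of 0 0] B by auto
  also have "B \<le> B / (1 - q)"
    using q B mult_left_le[of q B] by (simp add: field_simps)
  finally have "\<bar>f d - f 0\<bar> \<le> B / (1 - q) + B / (1 - q)" using 1 by linarith
  then show ?thesis by simp
qed

section \<open>Continuous extension from the dyadic numbers\<close>

text \<open>An explicit approximating sequence that does not depend on the path, so that limits
  along it are measurable in \<omega>. For negative \<open>t\<close> the function \<open>nat\<close>
  makes the value 0.\<close>

definition dyadic_floor :: "nat \<Rightarrow> real \<Rightarrow> real" where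
  "dyadic_floor k t = real (nat \<lfloor>2 ^ k * t\<rfloor>) / 2 ^ k"

lemma dyadic_floor_in: "dyadic_floor k t \<in> dyadics"
  by (auto simp: dyadic_floor_def dyadics_def)

lemma dyadic_floor_bounds:
  assumes "t \<ge> 0"
  shows "dyadic_floor k t \<ge> 0" "dyadic_floor k t \<le> t" "t - dyadic_floor k t \<le> 1 / 2 ^ k"
proof -
  have "real (nat \<lfloor>2 ^ k * t\<rfloor>) = of_int \<lfloor>2 ^ k * t\<rfloor>" using assms by simp
  then have *: "dyadic_floor k t = of_int \<lfloor>2 ^ k * t\<rfloor> / 2 ^ k" by (simp add: dyadic_floor_def)
  show "dyadic_floor k t \<ge> 0" by (simp add: dyadic_floor_def)
  have "of_int \<lfloor>2 ^ k * t\<rfloor> \<le> 2 ^ k * t" "2 ^ k * t \<le> of_int \<lfloor>2 ^ k * t\<rfloor> + 1" by linarith+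
  then have "of_int \<lfloor>2 ^ k * t\<rfloor> / 2 ^ k \<le> t" "t \<le> (of_int \<lfloor>2 ^ k * t\<rfloor> + 1) / 2 ^ k"
    by (simp_all add: pos_divide_le_eq pos_le_divide_eq mult.commute)
  then show "dyadic_floor k t \<le> t" "t - dyadic_floor k t \<le> 1 / 2 ^ k"
    unfolding * by (simp_all add: add_divide_distrib)
qed

lemma dyadic_floor_tendsto:
  assumes "t \<ge> 0"
  shows "(\<lambda>k. dyadic_floor k t) \<longlonglongrightarrow> t"
proof -
  have "(\<lambda>k. (1 / 2 :: real) ^ k) \<longlonglongrightarrow> 0" by (intro LIMSEQ_power_zero) simp
  from tendsto_diff[OF tendsto_const this, of t] have lim: "(\<lambda>k. t - (1 / 2) ^ k) \<longlonglongrightarrow> t"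
    by simp
  have lo: "\<forall>\<^sub>F k in sequentially. t - (1 / 2) ^ k \<le> dyadic_floor k t"
    using dyadic_floor_bounds(3)[OF assms] by (intro always_eventually allI) (simp add: power_divide algebra_simps)
  have hi: "\<forall>\<^sub>F k in sequentially. dyadic_floor k t \<le> t"
    using dyadic_floor_bounds(2)[OF assms] by (intro always_eventually allI)
  show ?thesis
    by (rule tendsto_sandwich[OF lo hi lim tendsto_const])
qed

text \<open>On each bounded piece a uniformly continuous function extends continuously to the
  closure. The limit along \<open>dyadic_floor\<close> picks out the value of that extension
  whichever \<open>n\<close> is used, so the pieces fit together.\<close>

lemma dyadic_extension:
  fixes f :: "real \<Rightarrow> real"
  assumes uc: "\<And>n::nat. uniformly_continuous_on (dyadics \<inter> {0..2 ^ n}) f"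
  shows dyadic_extension_tendsto:
      "t \<ge> 0 \<Longrightarrow> (\<lambda>k. f (dyadic_floor k t)) \<longlonglongrightarrow> lim (\<lambda>k. f (dyadic_floor k t))"
    and dyadic_extension_continuous: "continuous_on {0..} (\<lambda>t. lim (\<lambda>k. f (dyadic_floor k t)))"
proof -
  define F where "F = (\<lambda>t. lim (\<lambda>k. f (dyadic_floor k t)))"
  have ex: "\<exists>g. continuous_on {0..<2 ^ n} g \<and> (\<forall>t\<in>{0..<2 ^ n}. (\<lambda>k. f (dyadic_floor k t)) \<longlonglongrightarrow> g t)" for n :: nat
  proof -
    obtain g where g: "uniformly_continuous_on (closure (dyadics \<inter> {0..2 ^ n})) g"
      "\<And>x. x \<in> dyadics \<inter> {0..2 ^ n} \<Longrightarrow> f x = g x"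
      using uniformly_continuous_on_extension_on_closure[OF uc[of n]] by metis
    have in_D: "dyadic_floor k t \<in> dyadics \<inter> {0..2 ^ n}" if "t \<in> {0..<2 ^ n}" for t k
      using that dyadic_floor_bounds[of t k] dyadic_floor_in[of k t] by auto
    have cl: "t \<in> closure (dyadics \<inter> {0..2 ^ n})" if "t \<in> {0..<2 ^ n}" for t
      unfolding closure_sequential using in_D[OF that] dyadic_floor_tendsto[of t] that
      by (intro exI[of _ "\<lambda>k. dyadic_floor k t"]) auto
    have cont: "continuous_on (closure (dyadics \<inter> {0..2 ^ n})) g"
      using g(1) by (rule uniformly_continuous_imp_continuous)
    have "(\<lambda>k. f (dyadic_floor k t)) \<longlonglongrightarrow> g t" if t: "t \<in> {0..<2 ^ n}" for t
    proof -
      have "(\<lambda>k. g (dyadic_floor k t)) \<longlonglongrightarrow> g t"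
      proof (rule continuous_on_tendsto_compose[OF cont _ cl[OF t]])
        show "(\<lambda>k. dyadic_floor k t) \<longlonglongrightarrow> t" using t by (intro dyadic_floor_tendsto) auto
        show "\<forall>\<^sub>F k in sequentially. dyadic_floor k t \<in> closure (dyadics \<inter> {0..2 ^ n})"
          using in_D[OF t] closure_subset by (intro always_eventually) blast
      qed
      then show ?thesis using g(2)[OF in_D[OF t]] by simp
    qed
    moreover have "continuous_on {0..<2 ^ n} g" using cont cl by (meson continuous_on_subset subsetI)
    ultimately show ?thesis by blast
  qed
  have pow: "\<exists>n::nat. t < 2 ^ n" for t :: real by (simp add: real_arch_pow)
  show "(\<lambda>k. f (dyadic_floor k t)) \<longlonglongrightarrow> lim (\<lambda>k. f (dyadic_floor k t))" if "t \<ge> 0" for t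
  proof -
    obtain n :: nat where "t < 2 ^ n" using pow by blast
    then have "convergent (\<lambda>k. f (dyadic_floor k t))" using ex[of n] that by (auto simp: convergent_def)
    then show ?thesis by (simp add: convergent_LIMSEQ_iff)
  qed
  have cF: "continuous_on {0..<2 ^ n} F" for n :: nat
  proof -
    obtain g where g: "continuous_on {0..<2 ^ n} g"
      "\<And>t. t\<in>{0..<2 ^ n} \<Longrightarrow> (\<lambda>k. f (dyadic_floor k t)) \<longlonglongrightarrow> g t" using ex[of n] by blast
    have "F t = g t" if "t \<in> {0..<2 ^ n}" for t unfolding F_def using g(2)[OF that] by (rule limI)
    then show ?thesis using g(1) continuous_on_cong[OF refl, of "{0..<2 ^ n}" F g] by blast
  qed
  have "continuous (at t within {0..}) F" if "t \<ge> 0" for t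
  proof -
    obtain n :: nat where n: "t < 2 ^ n" using pow by blast
    then have "continuous (at t within {0..<2 ^ n}) F"
      using cF[of n] that by (simp add: continuous_on_eq_continuous_within)
    \<comment> \<open>The half-open interval is relatively open in the half line, so continuity on
      the pieces is continuity on the whole.\<close>
    moreover have "at t within {0..<2 ^ n} = at t within {0..}"
      by (rule at_within_nhd[of t "{..<2 ^ n}"]) (use n in auto)
    ultimately show ?thesis by simp
  qed
  then show "continuous_on {0..} (\<lambda>t. lim (\<lambda>k. f (dyadic_floor k t)))"
    unfolding F_def[symmetric] by (simp add: continuous_on_eq_continuous_within)
qed

section \<open>Laws and tails of the increments\<close>

lemma fdd_eq_marginal:
  assumes "fdd_eq M Y Z" "t \<ge> 0" "Y t \<in> borel_measurable M" "Z t \<in> borel_measurable M"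
  shows "distr M borel (Y t) = distr M borel (Z t)"
proof -
  have marg: "distr (distr M (Pi\<^sub>M {t} (\<lambda>_. borel)) (\<lambda>\<omega>. \<lambda>s\<in>{t}. W s \<omega>)) borel (\<lambda>f. f t) = distr M borel (W t)"
    if "W t \<in> borel_measurable M" for W :: "real \<Rightarrow> 'a \<Rightarrow> real"
  proof -
    have "(\<lambda>\<omega>. \<lambda>s\<in>{t}. W s \<omega>) \<in> measurable M (Pi\<^sub>M {t} (\<lambda>_. borel))"
      using that by (intro measurable_restrict) auto
    then show ?thesis by (subst distr_distr) (auto simp: o_def)
  qed
  have "distr M (Pi\<^sub>M {t} (\<lambda>_. borel)) (\<lambda>\<omega>. \<lambda>s\<in>{t}. Y s \<omega>) =
    distr M (Pi\<^sub>M {t} (\<lambda>_. borel)) (\<lambda>\<omega>. \<lambda>s\<in>{t}. Z s \<omega>)"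
    using assms(1,2) by (auto simp: fdd_eq_def)
  then show ?thesis using marg[of Y] marg[of Z] assms(3,4) by simp
qed

lemma measure_eq_of_distr_eq:
  fixes f g :: "'a \<Rightarrow> 'b :: topological_space"
  assumes "distr M borel f = distr M borel g" "f \<in> borel_measurable M" "g \<in> borel_measurable M"
    "S \<in> sets borel"
  shows "measure M {\<omega> \<in> space M. f \<omega> \<in> S} = measure M {\<omega> \<in> space M. g \<omega> \<in> S}"
proof -
  have "{\<omega> \<in> space M. h \<omega> \<in> S} = h -` S \<inter> space M" for h :: "'a \<Rightarrow> 'b" by auto
  then show ?thesis
    using assms measure_distr[of f M borel S] measure_distr[of g M borel S] by simp
qed

text \<open>At time 0 self-similarity says that \<open>X 0\<close> and \<open>c powr H * X 0\<close>
  have the same law. Choosing \<open>c\<close> with \<open>c powr H = 1 / real (Suc n)\<close> and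
  letting \<open>n\<close> grow forces the law to be concentrated at 0.\<close>

lemma (in prob_space) self_similar_zero:
  assumes "self_similar M H X" "H > 0" and X0 [measurable]: "X 0 \<in> borel_measurable M"
  shows "AE \<omega> in M. X 0 \<omega> = 0"
proof -
  \<comment> \<open>A bounded \<open>g\<close>, since no moment of \<open>X 0\<close> is assumed.\<close>
  define g :: "real \<Rightarrow> real" where "g = (\<lambda>x. min 1 \<bar>x\<bar>)"
  have [measurable]: "g \<in> borel_measurable borel" by (simp add: g_def)
  have eq: "(\<integral>\<omega>. g (X 0 \<omega>) \<partial>M) = (\<integral>\<omega>. g (X 0 \<omega> / real (Suc n)) \<partial>M)" for n
  proof -
    define c where "c = (1 / real (Suc n)) powr (1 / H)"
    have c: "c > 0" "c powr H = 1 / real (Suc n)" using \<open>H > 0\<close> by (simp_all add: c_def powr_powr)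
    have "fdd_eq M (\<lambda>t \<omega>. X (c * t) \<omega>) (\<lambda>t \<omega>. c powr H * X t \<omega>)"
      using assms(1) c(1) by (simp add: self_similar_def)
    from fdd_eq_marginal[OF this, of 0]
    have "distr M borel (X 0) = distr M borel (\<lambda>\<omega>. X 0 \<omega> / real (Suc n))"
      by (simp add: c(2))
    then have "(\<integral>x. g x \<partial>distr M borel (X 0)) = (\<integral>x. g x \<partial>distr M borel (\<lambda>\<omega>. X 0 \<omega> / real (Suc n)))"
      by simp
    then show ?thesis by (subst (asm) (1 2) integral_distr) auto
  qed
  have "(\<lambda>n. \<integral>\<omega>. g (X 0 \<omega> / real (Suc n)) \<partial>M) \<longlonglongrightarrow> (\<integral>\<omega>. 0 \<partial>M)"
  proof (rule integral_dominated_convergence[where w = "\<lambda>_. 1"])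
    have "(\<lambda>n. g (x / real (Suc n))) \<longlonglongrightarrow> min 1 \<bar>0\<bar>" for x
      unfolding g_def by (intro tendsto_intros LIMSEQ_Suc[OF lim_const_over_n])
    then show "AE \<omega> in M. (\<lambda>n. g (X 0 \<omega> / real (Suc n))) \<longlonglongrightarrow> 0" by simp
  qed (auto simp: g_def)
  then have "(\<integral>\<omega>. g (X 0 \<omega>) \<partial>M) = 0"
    unfolding eq[symmetric] by (simp add: LIMSEQ_const_iff)
  moreover have "integrable M (\<lambda>\<omega>. g (X 0 \<omega>))"
    by (rule integrable_const_bound[where B = 1]) (auto simp: g_def)
  ultimately have "AE \<omega> in M. g (X 0 \<omega>) = 0"
    by (subst (asm) integral_nonneg_eq_0_iff_AE) (auto simp: g_def)
  then show ?thesis by eventually_elim (auto simp: g_def min_def split: if_splits)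
qed

text \<open>Stationarity moves the increment to \<open>X (t - s) - X 0\<close>, where
  \<open>X 0\<close> vanishes almost surely; self-similarity with factor \<open>t - s\<close> is
  then applied at time 1.\<close>

lemma (in prob_space) SSSI_increment_law:
  assumes "SSSI M H X" "H > 0" "0 \<le> s" "s < t"
  shows "distr M borel (\<lambda>\<omega>. X t \<omega> - X s \<omega>) = distr M borel (\<lambda>\<omega>. (t - s) powr H * X 1 \<omega>)"
proof -
  have [measurable]: "X u \<in> borel_measurable M" if "u \<ge> 0" for u
    using assms(1) that by (simp add: SSSI_def real_process_def)
  have [measurable]: "X 0 \<in> borel_measurable M" "X 1 \<in> borel_measurable M" "X s \<in> borel_measurable M"
    "X t \<in> borel_measurable M" "X (t - s) \<in> borel_measurable M"
    using assms by auto
  have "fdd_eq M (\<lambda>u \<omega>. X (s + u) \<omega> - X s \<omega>) (\<lambda>u \<omega>. X u \<omega> - X 0 \<omega>)"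
    using assms by (simp add: SSSI_def stationary_increments_def)
  from fdd_eq_marginal[OF this, of "t - s"]
  have "distr M borel (\<lambda>\<omega>. X t \<omega> - X s \<omega>) = distr M borel (\<lambda>\<omega>. X (t - s) \<omega> - X 0 \<omega>)"
    using assms by simp
  also have "\<dots> = distr M borel (X (t - s))"
    using self_similar_zero[of H X] assms by (intro distr_cong_AE) (auto simp: SSSI_def)
  also have "fdd_eq M (\<lambda>u \<omega>. X ((t - s) * u) \<omega>) (\<lambda>u \<omega>. (t - s) powr H * X u \<omega>)"
    using assms by (simp add: SSSI_def self_similar_def)
  from fdd_eq_marginal[OF this, of 1]
  have "distr M borel (X (t - s)) = distr M borel (\<lambda>\<omega>. (t - s) powr H * X 1 \<omega>)"
    by simp
  finally show ?thesis .
qed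

lemma (in prob_space) SSSI_increment_tail:
  assumes "SSSI M H X" "H > 0" "p > 0" and int: "integrable M (\<lambda>\<omega>. \<bar>X 1 \<omega>\<bar> powr p)"
    and "0 \<le> s" "s < t" "a > 0"
  shows "prob {\<omega> \<in> space M. a \<le> \<bar>X t \<omega> - X s \<omega>\<bar>}
    \<le> (\<integral>\<omega>. \<bar>X 1 \<omega>\<bar> powr p \<partial>M) * ((t - s) powr H / a) powr p"
proof -
  have [measurable]: "X u \<in> borel_measurable M" if "u \<ge> 0" for u
    using assms(1) that by (simp add: SSSI_def real_process_def)
  have [measurable]: "X 1 \<in> borel_measurable M" "X s \<in> borel_measurable M" "X t \<in> borel_measurable M"
    using assms by auto
  define c where "c = (t - s) powr H"
  have "c > 0" using assms by (simp add: c_def)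
  have "prob {\<omega> \<in> space M. X t \<omega> - X s \<omega> \<in> {x. a \<le> \<bar>x\<bar>}} = prob {\<omega> \<in> space M. c * X 1 \<omega> \<in> {x. a \<le> \<bar>x\<bar>}}"
    unfolding c_def using SSSI_increment_law[OF assms(1,2,5,6)]
    by (rule measure_eq_of_distr_eq) auto
  then have "prob {\<omega> \<in> space M. a \<le> \<bar>X t \<omega> - X s \<omega>\<bar>} = prob {\<omega> \<in> space M. a \<le> \<bar>c * X 1 \<omega>\<bar>}" by simp
  \<comment> \<open>Both sides are raised to the power \<open>p\<close> so that Markov's inequality
    applies to the integrable variable.\<close>
  also have "{\<omega> \<in> space M. a \<le> \<bar>c * X 1 \<omega>\<bar>} = {\<omega> \<in> space M. (a / c) powr p \<le> \<bar>X 1 \<omega>\<bar> powr p}"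
  proof (rule Collect_cong, rule conj_cong[OF refl])
    fix \<omega>
    have "(a / c) powr p \<le> \<bar>X 1 \<omega>\<bar> powr p \<longleftrightarrow> a / c \<le> \<bar>X 1 \<omega>\<bar>"
      using \<open>p > 0\<close> \<open>a > 0\<close> \<open>c > 0\<close> powr_mono2[of p "a / c" "\<bar>X 1 \<omega>\<bar>"] powr_less_mono2[of p "\<bar>X 1 \<omega>\<bar>" "a / c"]
      by force
    also have "\<dots> \<longleftrightarrow> a \<le> \<bar>c * X 1 \<omega>\<bar>" using \<open>c > 0\<close> by (simp add: abs_mult field_simps)
    finally show "a \<le> \<bar>c * X 1 \<omega>\<bar> \<longleftrightarrow> (a / c) powr p \<le> \<bar>X 1 \<omega>\<bar> powr p" by simp
  qed
  also have "prob \<dots> \<le> (\<integral>\<omega>. \<bar>X 1 \<omega>\<bar> powr p \<partial>M) / (a / c) powr p"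
    using \<open>a > 0\<close> \<open>c > 0\<close> by (intro integral_Markov_inequality_measure[OF int sets.top]) auto
  also have "\<dots> = (\<integral>\<omega>. \<bar>X 1 \<omega>\<bar> powr p \<partial>M) * (c / a) powr p"
    using \<open>a > 0\<close> \<open>c > 0\<close> by (simp add: powr_divide)
  finally show ?thesis unfolding c_def .
qed

section \<open>Borel--Cantelli estimates along dyadic times\<close>

lemma (in prob_space) borel_cantelli_summable:
  assumes "\<And>n. A n \<in> events" "\<And>n. prob (A n) \<le> g n" "summable g"
  shows "AE \<omega> in M. \<forall>\<^sub>F n in sequentially. \<omega> \<notin> A n"
proof -
  have "summable (\<lambda>n. prob (A n))"
    by (rule summable_comparison_test'[OF assms(3), of 0]) (use assms(2) in auto)
  then have "AE \<omega> in M. \<forall>\<^sub>F n in sequentially. \<omega> \<in> space M - A n"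
    using assms(1) by (intro borel_cantelli_AE1) (auto simp: emeasure_eq_measure)
  then show ?thesis by (auto elim!: eventually_mono)
qed

text \<open>A Kolmogorov continuity condition in tail form: the exponent \<open>H * p\<close> of
  \<open>t - s\<close> exceeds 1. Self-similarity and stationarity enter the path estimates only
  through these assumptions.\<close>

locale increment_tail = prob_space M for M :: "'a measure" +
  fixes X :: "real \<Rightarrow> 'a \<Rightarrow> real" and H p K :: real
  assumes X_measurable [measurable]: "t \<ge> 0 \<Longrightarrow> X t \<in> borel_measurable M"
    and H_pos: "H > 0" and p_pos: "p > 0" and Hp: "H * p > 1" and K_nonneg: "K \<ge> 0"
    and X_zero: "AE \<omega> in M. X 0 \<omega> = 0"
    and tail: "0 \<le> s \<Longrightarrow> s < t \<Longrightarrow> a > 0 \<Longrightarrow>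
      prob {\<omega> \<in> space M. a \<le> \<bar>X t \<omega> - X s \<omega>\<bar>} \<le> K * ((t - s) powr H / a) powr p"
begin

text \<open>
  \<open>r\<close> is the ratio by which the bound on the probability of a large increment changes from one dyadic
  level to the next; any exponent of \<open>1 / 2\<close> in \<open>q\<close> strictly between \<open>0\<close> and \<open>H - 1 / p\<close> gives \<open>r < 1\<close>.
\<close>

definition q :: real where "q = 2 powr (- ((H - 1 / p) / 2))"
definition r :: real where "r = 2 * (2 powr (- H) / q) powr p"

lemma q_bounds: "0 < q" "q < 1"
proof -
  have "1 / p < H" using Hp p_pos by (simp add: field_simps)
  then show "0 < q" "q < 1" using powr_less_mono[of "- ((H - 1 / p) / 2)" 0 2] by (simp_all add: q_def)
qed

lemma r_bounds: "0 < r" "r < 1"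
proof -
  have "r = 2 * (2 powr (- H + (H - 1 / p) / 2)) powr p"
    unfolding r_def q_def by (simp add: powr_diff[symmetric])
  also have "\<dots> = 2 powr 1 * 2 powr ((- H + (H - 1 / p) / 2) * p)"
    by (simp add: powr_powr)
  also have "\<dots> = 2 powr (1 + (- H + (H - 1 / p) / 2) * p)"
    by (rule powr_add[symmetric])
  \<comment> \<open>Thus \<open>r\<close> is the square root of \<open>2 powr (1 - H * p)\<close>,
    the ratio for thresholds constant in the level; the other half of the decay pays for the factor
    \<open>q ^ k\<close>.\<close>
  also have "1 + (- H + (H - 1 / p) / 2) * p = - (H * p - 1) / 2"
    using p_pos by (simp add: field_simps)
  finally have "r = 2 powr (- (H * p - 1) / 2)" .
  then show "0 < r" "r < 1" using Hp using powr_less_mono[of "- (H * p - 1) / 2" 0 2] by simp_all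
qed

text \<open>Off this event the level \<open>k\<close> hypothesis of the chaining lemmas holds on
  [0, 2^n].\<close>

definition bad :: "real \<Rightarrow> nat \<Rightarrow> nat \<Rightarrow> 'a set" where
  "bad B n k = {\<omega> \<in> space M. \<exists>j<2 ^ k.
     B * q ^ k \<le> \<bar>X (real (Suc j) * 2 ^ n / 2 ^ k) \<omega> - X (real j * 2 ^ n / 2 ^ k) \<omega>\<bar>}"

lemma sets_bad [measurable]: "bad B n k \<in> events"
  unfolding bad_def by measurable

text \<open>A union bound over the \<open>2 ^ k\<close> increments, all of length
  \<open>2 ^ n / 2 ^ k\<close>. Their number is absorbed by the factor 2 in
  \<open>r\<close>.\<close>

lemma prob_bad:
  assumes "B > 0"
  shows "prob (bad B n k) \<le> K * ((2 ^ n) powr H / B) powr p * r ^ k"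
proof -
  define E where "E j = {\<omega> \<in> space M.
    B * q ^ k \<le> \<bar>X (real (Suc j) * 2 ^ n / 2 ^ k) \<omega> - X (real j * 2 ^ n / 2 ^ k) \<omega>\<bar>}" for j
  have [measurable]: "E j \<in> events" for j
    unfolding E_def by measurable
  have "bad B n k = (\<Union>j<2 ^ k. E j)" by (auto simp: bad_def E_def)
  then have "prob (bad B n k) \<le> (\<Sum>j<2 ^ k. prob (E j))"
    by (simp add: measure_UNION_le)
  also have "\<dots> \<le> (\<Sum>j<(2::nat) ^ k. K * ((2 ^ n / 2 ^ k) powr H / (B * q ^ k)) powr p)"
  proof (rule sum_mono)
    fix j
    have "real (Suc j) * 2 ^ n / 2 ^ k - real j * 2 ^ n / 2 ^ k = 2 ^ n / 2 ^ k"
      by (simp add: field_simps)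
    then show "prob (E j) \<le> K * ((2 ^ n / 2 ^ k) powr H / (B * q ^ k)) powr p"
      unfolding E_def using tail[of "real j * 2 ^ n / 2 ^ k" "real (Suc j) * 2 ^ n / 2 ^ k" "B * q ^ k"]
        assms q_bounds by (simp add: divide_strict_right_mono)
  qed
  also have "\<dots> = 2 ^ k * (K * ((2 ^ n / 2 ^ k) powr H / (B * q ^ k)) powr p)" by simp
  also have "(2 ^ n / 2 ^ k) powr H / (B * q ^ k) = ((2 ^ n) powr H / B) * (2 powr (- H) / q) ^ k"
  proof -
    have "(2 ^ k :: real) powr H = (2 powr H) ^ k"
      by (simp add: powr_powr powr_power powr_realpow[symmetric] mult.commute)
    then show ?thesis by (simp add: powr_divide powr_minus power_divide field_simps)
  qed
  also have "\<dots> powr p = ((2 ^ n) powr H / B) powr p * ((2 powr (- H) / q) powr p) ^ k"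
  proof -
    have "((2 powr (- H) / q) ^ k) powr p = ((2 powr (- H) / q) powr p) ^ k"
      using q_bounds by (simp add: powr_powr powr_power powr_realpow[symmetric] mult.commute)
    then show ?thesis
      using q_bounds assms powr_mult[of "(2 ^ n) powr H / B" "(2 powr (- H) / q) ^ k" p] by simp
  qed
  finally show ?thesis by (simp add: r_def power_mult_distrib mult_ac)
qed

lemma not_bad:
  assumes "\<omega> \<in> space M" "\<omega> \<notin> bad B n k" "j < 2 ^ k"
  shows "\<bar>X (real (Suc j) * 2 ^ n / 2 ^ k) \<omega> - X (real j * 2 ^ n / 2 ^ k) \<omega>\<bar> \<le> B * q ^ k"
  using assms unfolding bad_def by force

text \<open>For fixed \<open>n\<close> the probabilities are summable in \<open>k\<close>. The
  threshold constant 1 is arbitrary here, since only the behaviour at high levels matters.\<close>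

lemma AE_uniformly_continuous:
  "AE \<omega> in M. \<forall>n::nat. uniformly_continuous_on (dyadics \<inter> {0..2 ^ n}) (\<lambda>t. X t \<omega>)"
proof (rule AE_all_countable[THEN iffD2], rule allI)
  fix n :: nat
  have "AE \<omega> in M. \<forall>\<^sub>F k in sequentially. \<omega> \<notin> bad 1 n k"
    by (rule borel_cantelli_summable[OF sets_bad prob_bad])
       (use r_bounds in \<open>auto intro!: summable_mult summable_geometric\<close>)
  then show "AE \<omega> in M. uniformly_continuous_on (dyadics \<inter> {0..2 ^ n}) (\<lambda>t. X t \<omega>)"
    using AE_space
  proof eventually_elim
    case (elim \<omega>)
    then obtain k0 where "\<And>k. k \<ge> k0 \<Longrightarrow> \<omega> \<notin> bad 1 n k"
      unfolding eventually_sequentially by blast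
    with elim(2) show ?case
      using dyadic_uniformly_continuous[of q k0 "\<lambda>t. X t \<omega>" n 1] q_bounds not_bad[of \<omega> 1 n] by simp
  qed
qed

lemma AE_dyadic_growth:
  assumes "e > 0"
  shows "AE \<omega> in M. \<forall>\<^sub>F n in sequentially. \<forall>d\<in>dyadics. d \<le> 2 ^ n \<longrightarrow>
    \<bar>X d \<omega>\<bar> \<le> 2 / (1 - q) * (real (Suc n) powr (1 / p + e) * (2 ^ n) powr H)"
proof -
  \<comment> \<open>The factor \<open>(2 ^ n) powr H\<close> cancels the scale of [0, 2^n] in
    \<open>prob_bad\<close>. The power of \<open>Suc n\<close> then contributes the exponent
    \<open>- (1 + e * p)\<close>, just inside the summable range; \<open>Suc n\<close> keeps
    \<open>B 0\<close> positive.\<close>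
  define B where "B n = real (Suc n) powr (1 / p + e) * (2 ^ n) powr H" for n
  have B: "B n > 0" for n by (simp add: B_def)
  define C where "C n = K * ((2 ^ n) powr H / B n) powr p" for n
  have C: "C n = K * real (Suc n) powr (- (1 + e * p))" for n
  proof -
    have "(2 ^ n) powr H / B n = real (Suc n) powr (- (1 / p + e))"
      unfolding B_def powr_minus by (simp add: field_simps)
    moreover have "- (1 / p + e) * p = - (1 + e * p)" using p_pos by (simp add: field_simps)
    ultimately show ?thesis by (simp add: C_def powr_powr)
  qed
  \<comment> \<open>All levels are taken at once, because \<open>dyadic_bound\<close> needs control
    from level 0 on.\<close>
  have "prob (\<Union>k. bad (B n) n k) \<le> C n * (1 / (1 - r))" for n
  proof -
    have le: "prob (bad (B n) n k) \<le> C n * r ^ k" for k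
      using prob_bad[OF B] by (simp add: C_def)
    have sm: "summable (\<lambda>k. C n * r ^ k)"
      using r_bounds by (intro summable_mult summable_geometric) simp
    have sp: "summable (\<lambda>k. prob (bad (B n) n k))"
      by (rule summable_comparison_test'[OF sm, of 0]) (use le in auto)
    have "prob (\<Union>k. bad (B n) n k) \<le> (\<Sum>k. prob (bad (B n) n k))"
      by (rule finite_measure_subadditive_countably[OF _ sp]) auto
    also have "\<dots> \<le> (\<Sum>k. C n * r ^ k)" by (rule suminf_le[OF le sp sm])
    also have "\<dots> = C n * (1 / (1 - r))"
      using r_bounds by (subst suminf_mult) (auto simp: suminf_geometric summable_geometric)
    finally show ?thesis .
  qed
  moreover have "summable (\<lambda>n. C n * (1 / (1 - r)))"
  proof -
    have "summable (\<lambda>n. real n powr (- (1 + e * p)))"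
      using \<open>e > 0\<close> p_pos by (simp add: summable_real_powr_iff)
    then have "summable (\<lambda>n. real (Suc n) powr (- (1 + e * p)))"
      by (subst summable_Suc_iff)
    then show ?thesis unfolding C by (intro summable_mult summable_mult2)
  qed
  ultimately have "AE \<omega> in M. \<forall>\<^sub>F n in sequentially. \<omega> \<notin> (\<Union>k. bad (B n) n k)"
    by (rule borel_cantelli_summable[rotated]) measurable
  then show ?thesis
    using AE_space X_zero
  proof eventually_elim
    case (elim \<omega>)
    from elim(1) show ?case
    proof eventually_elim
      case (elim n)
      show ?case
      proof (intro ballI impI)
        fix d :: real assume "d \<in> dyadics" "d \<le> 2 ^ n"
        then have "\<bar>X d \<omega> - X 0 \<omega>\<bar> \<le> 2 * B n / (1 - q)"
          using dyadic_bound[of q "\<lambda>t. X t \<omega>" n "B n" d] q_bounds not_bad[of \<omega> "B n" n]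
            elim \<open>\<omega> \<in> space M\<close> B[of n] by (simp add: less_imp_le)
        then show "\<bar>X d \<omega>\<bar> \<le> 2 / (1 - q) * (real (Suc n) powr (1 / p + e) * (2 ^ n) powr H)"
          using \<open>X 0 \<omega> = 0\<close> by (simp add: B_def)
      qed
    qed
  qed
qed

text \<open>This identifies the extension at a fixed time, dyadic or not, with \<open>X t\<close>,
  and so makes it a modification.\<close>

lemma AE_dyadic_floor_tendsto:
  assumes "t \<ge> 0"
  shows "AE \<omega> in M. (\<lambda>k. X (dyadic_floor k t) \<omega>) \<longlonglongrightarrow> X t \<omega>"
proof -
  \<comment> \<open>The threshold \<open>b ^ k\<close> is the square root of the increment scale
    \<open>(1 / 2 ^ k) powr H\<close>: it tends to 0, yet the tail bound still leaves the summable
    \<open>c ^ k\<close>.\<close>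
  define b where "b = (2::real) powr (- (H / 2))"
  define c where "c = (2::real) powr (- (H / 2) * p)"
  have b: "0 < b" "b < 1" using H_pos using powr_less_mono[of "- (H / 2)" 0 2] by (simp_all add: b_def)
  have c: "0 < c" "c < 1" using H_pos p_pos using powr_less_mono[of "- (H / 2) * p" 0 2] by (simp_all add: c_def)
  define A where "A k = {\<omega> \<in> space M. b ^ k \<le> \<bar>X t \<omega> - X (dyadic_floor k t) \<omega>\<bar>}" for k
  have "A k \<in> events" for k
    unfolding A_def using assms dyadic_floor_bounds(1)[OF assms, of k] by measurable
  moreover have "prob (A k) \<le> K * c ^ k" for k
  \<comment> \<open>The tail bound requires two distinct times.\<close>
  proof (cases "dyadic_floor k t = t")
    case True
    then have "A k = {}" using b by (auto simp: A_def not_le)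
    then show ?thesis using c K_nonneg by simp
  next
    case False
    define u where "u = t - dyadic_floor k t"
    have u: "0 < u" "u \<le> 1 / 2 ^ k"
      using False dyadic_floor_bounds[OF assms, of k] by (auto simp: u_def)
    have "prob (A k) \<le> K * (u powr H / b ^ k) powr p"
      unfolding A_def u_def using dyadic_floor_bounds[OF assms, of k] u b
      by (intro tail) (auto simp: u_def)
    also have "\<dots> \<le> K * ((1 / 2 ^ k) powr H / b ^ k) powr p"
      using K_nonneg u b H_pos p_pos
      by (intro mult_left_mono powr_mono2 divide_right_mono) auto
    also have "((1 / 2 ^ k) powr H / b ^ k) powr p = c ^ k"
    proof -
      have "1 / 2 ^ k = (2::real) powr (- real k)" by (simp add: powr_minus powr_realpow field_simps)
      moreover have "b ^ k = 2 powr (- (H / 2) * real k)" by (simp add: b_def powr_power mult.commute)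
      ultimately have "((1 / 2 ^ k) powr H / b ^ k) powr p
          = 2 powr ((- real k * H - - (H / 2) * real k) * p)"
        by (simp only: powr_powr powr_diff[symmetric])
      also have "(- real k * H - - (H / 2) * real k) * p = real k * (- (H / 2) * p)"
        by (simp add: field_simps)
      finally show ?thesis by (simp only: c_def powr_power zero_neq_numeral not_False_eq_True simp_thms)
    qed
    finally show ?thesis .
  qed
  moreover have "summable (\<lambda>k. K * c ^ k)"
    using c by (intro summable_mult summable_geometric) simp
  ultimately have "AE \<omega> in M. \<forall>\<^sub>F k in sequentially. \<omega> \<notin> A k"
    by (rule borel_cantelli_summable)
  then show ?thesis
    using AE_space
  proof eventually_elim
    case (elim \<omega>)
    have "(\<lambda>k. b ^ k) \<longlonglongrightarrow> 0" using b by (intro LIMSEQ_power_zero) simp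
    moreover have "\<forall>\<^sub>F k in sequentially. norm (X (dyadic_floor k t) \<omega> - X t \<omega>) \<le> b ^ k"
      using elim(1) by eventually_elim (use elim(2) in \<open>auto simp: A_def abs_minus_commute\<close>)
    ultimately have "(\<lambda>k. X (dyadic_floor k t) \<omega> - X t \<omega>) \<longlonglongrightarrow> 0"
      by (rule Lim_null_comparison[rotated])
    then show ?case by (simp add: LIM_zero_iff)
  qed
qed

end

section \<open>From dyadic blocks to continuous time\<close>

text \<open>In the block \<open>2 ^ (n - 1) \<le> t < 2 ^ n\<close> the scale
  \<open>(2 ^ n) powr H\<close> is at most \<open>2 powr H * t powr H\<close>, and \<open>n\<close>
  is comparable to \<open>ln t\<close>. The surplus \<open>e\<close> in the exponent of the
  logarithm makes the quotient vanish.\<close>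

lemma powr_log_growth_tendsto_zero:
  fixes g :: "real \<Rightarrow> real"
  assumes "H > 0" "a \<ge> 0" "e > 0" "C \<ge> 0"
    and bound: "\<forall>\<^sub>F n in sequentially. \<forall>t\<in>{0..<2 ^ n}. \<bar>g t\<bar> \<le> C * (real (Suc n) powr a * (2 ^ n) powr H)"
  shows "((\<lambda>t. \<bar>g t\<bar> / (t powr H * ln t powr (a + e))) \<longlongrightarrow> 0) at_top"
proof -
  define h where "h t = C * 2 powr H * ((log 2 t + 2) powr a / ln t powr (a + e))" for t :: real
  obtain N :: nat where N: "\<And>n t. n \<ge> N \<Longrightarrow> t \<in> {0..<2 ^ n} \<Longrightarrow> \<bar>g t\<bar> \<le> C * (real (Suc n) powr a * (2 ^ n) powr H)"
    using bound unfolding eventually_sequentially by blast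
  have le: "\<bar>g t\<bar> / (t powr H * ln t powr (a + e)) \<le> h t" if t: "t \<ge> 2 ^ Suc N" for t
  proof -
    have "(1::real) < 2 ^ Suc N" by (rule one_less_power) auto
    with t have "t > 1" by linarith
    \<comment> \<open>The added 1 gives the strict bound \<open>t < 2 ^ n\<close>; it also makes
      \<open>Suc n\<close> at most \<open>log 2 t + 2\<close>, the term in \<open>h\<close>.\<close>
    define n where "n = nat \<lfloor>log 2 t\<rfloor> + 1"
    have log_ge: "log 2 t \<ge> real (Suc N)"
      using t \<open>t > 1\<close> by (simp add: le_log_iff powr_realpow del: power_Suc of_nat_Suc)
    then have n: "real n \<le> log 2 t + 1" "log 2 t < real n" by (auto simp: n_def) linarith+
    have "N \<le> n" using log_ge n by linarith
    have "t = 2 powr log 2 t" using \<open>t > 1\<close> by simp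
    also have "\<dots> < 2 powr real n" using n by (intro powr_less_mono) auto
    finally have "t < 2 ^ n" by (simp add: powr_realpow)
    have "(2::real) ^ n = 2 powr real n" by (simp add: powr_realpow)
    also have "\<dots> \<le> 2 powr (log 2 t + 1)" using n by (intro powr_mono) auto
    also have "\<dots> = 2 * t" using \<open>t > 1\<close> by (simp add: powr_add)
    finally have "(2 ^ n) powr H \<le> (2 * t) powr H" using \<open>H > 0\<close> by (intro powr_mono2) auto
    then have pH: "(2 ^ n) powr H \<le> 2 powr H * t powr H" using \<open>t > 1\<close> by (simp add: powr_mult)
    have pa: "real (Suc n) powr a \<le> (log 2 t + 2) powr a"
      using n \<open>a \<ge> 0\<close> by (intro powr_mono2) auto
    have "\<bar>g t\<bar> \<le> C * (real (Suc n) powr a * (2 ^ n) powr H)"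
      by (rule N) (use \<open>N \<le> n\<close> \<open>t > 1\<close> \<open>t < 2 ^ n\<close> in auto)
    also have "\<dots> \<le> C * ((log 2 t + 2) powr a * (2 powr H * t powr H))"
      using pH pa \<open>C \<ge> 0\<close> by (intro mult_left_mono mult_mono) auto
    finally have "\<bar>g t\<bar> / (t powr H * ln t powr (a + e)) \<le>
      C * ((log 2 t + 2) powr a * (2 powr H * t powr H)) / (t powr H * ln t powr (a + e))"
      by (intro divide_right_mono) auto
    also have "\<dots> = h t" using \<open>t > 1\<close> by (simp add: h_def)
    finally show ?thesis .
  qed
  have "((\<lambda>t. (log 2 t + 2) powr a / ln t powr (a + e)) \<longlongrightarrow> 0) at_top"
    unfolding log_def using \<open>e > 0\<close> \<open>a \<ge> 0\<close> by real_asymp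
  from tendsto_mult[OF tendsto_const this, of "C * 2 powr H"] have "(h \<longlongrightarrow> 0) at_top"
    unfolding h_def by simp
  then show ?thesis
  proof (rule Lim_null_comparison[rotated])
    show "\<forall>\<^sub>F t in at_top. norm (\<bar>g t\<bar> / (t powr H * ln t powr (a + e))) \<le> h t"
      using eventually_ge_at_top[of "2 ^ Suc N"] by eventually_elim (use le in auto)
  qed
qed

section \<open>The continuous modification and its growth\<close>

text \<open>The construction of \<open>Y\<close> does not involve \<open>\<epsilon>\<close>, so one
  modification serves every \<open>\<epsilon>\<close>.\<close>

lemma (in increment_tail) ex_continuous_modification:
  obtains Y where "is_modification M X Y" "continuous_paths M Y"
    "\<And>\<epsilon>. \<epsilon> > 0 \<Longrightarrow> AE \<omega> in M. ((\<lambda>t. \<bar>Y t \<omega>\<bar> / (t powr H * ln t powr (1 / p + \<epsilon>))) \<longlongrightarrow> 0) at_top"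
proof -
  obtain N where N: "{\<omega> \<in> space M. \<not> (\<forall>n::nat. uniformly_continuous_on (dyadics \<inter> {0..2 ^ n}) (\<lambda>t. X t \<omega>))} \<subseteq> N"
    "emeasure M N = 0" "N \<in> events"
    using AE_E[OF AE_uniformly_continuous] by blast
  have uc: "uniformly_continuous_on (dyadics \<inter> {0..2 ^ n}) (\<lambda>t. X t \<omega>)"
    if "\<omega> \<in> space M" "\<omega> \<notin> N" for \<omega> and n :: nat
    using N(1) that by blast
  have AE_N: "AE \<omega> in M. \<omega> \<notin> N" using N by (intro AE_not_in) (simp add: null_sets_def)
  \<comment> \<open>The value 0 on \<open>N\<close> makes every path continuous, not just almost
    every one. \<open>N\<close> is a measurable null set, so the case distinction preserves
    measurability.\<close>
  define Y where "Y t \<omega> = (if \<omega> \<in> N then 0 else lim (\<lambda>k. X (dyadic_floor k t) \<omega>))" for t \<omega>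
  have lim: "(\<lambda>k. X (dyadic_floor k t) \<omega>) \<longlonglongrightarrow> Y t \<omega>"
    if "\<omega> \<in> space M" "\<omega> \<notin> N" "t \<ge> 0" for t \<omega>
    using dyadic_extension_tendsto[of "\<lambda>t. X t \<omega>", OF uc[OF that(1,2)] that(3)] that by (simp add: Y_def)
  have "is_modification M X Y"
    unfolding is_modification_def real_process_def
  proof (intro conjI allI impI)
    fix t :: real assume t: "t \<ge> 0"
    have [measurable]: "X (dyadic_floor k t) \<in> borel_measurable M" for k
      using dyadic_floor_bounds(1)[OF t] by (rule X_measurable)
    have [measurable]: "N \<in> events" by fact
    show "Y t \<in> borel_measurable M" unfolding Y_def by measurable
    show "AE \<omega> in M. Y t \<omega> = X t \<omega>"
      using AE_dyadic_floor_tendsto[OF t] AE_N AE_space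
      by eventually_elim (use lim t in \<open>blast intro: LIMSEQ_unique\<close>)
  qed
  moreover have "continuous_paths M Y"
    unfolding continuous_paths_def
  proof
    fix \<omega> assume \<omega>: "\<omega> \<in> space M"
    show "continuous_on {0..} (\<lambda>t. Y t \<omega>)"
      using dyadic_extension_continuous[of "\<lambda>t. X t \<omega>", OF uc[OF \<omega>]]
      by (cases "\<omega> \<in> N") (auto simp: Y_def)
  qed
  moreover have "AE \<omega> in M. ((\<lambda>t. \<bar>Y t \<omega>\<bar> / (t powr H * ln t powr (1 / p + \<epsilon>))) \<longlongrightarrow> 0) at_top"
    if "\<epsilon> > 0" for \<epsilon>
  proof -
    \<comment> \<open>Half of \<open>\<epsilon>\<close> goes into the growth bound, the other half
      into the decay of the quotient.\<close>
    have "\<epsilon> / 2 > 0" using that by simp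
    from AE_dyadic_growth[OF this] AE_N AE_space show ?thesis
    proof eventually_elim
      case (elim \<omega>)
      from elim(1) have "\<forall>\<^sub>F n in sequentially. \<forall>t\<in>{0..<2 ^ n}.
        \<bar>Y t \<omega>\<bar> \<le> 2 / (1 - q) * (real (Suc n) powr (1 / p + \<epsilon> / 2) * (2 ^ n) powr H)"
      proof eventually_elim
        case (elim n)
        show ?case
        proof
          fix t :: real assume t: "t \<in> {0..<2 ^ n}"
          then have "(\<lambda>k. \<bar>X (dyadic_floor k t) \<omega>\<bar>) \<longlonglongrightarrow> \<bar>Y t \<omega>\<bar>"
            using lim \<open>\<omega> \<in> space M\<close> \<open>\<omega> \<notin> N\<close> by (intro tendsto_rabs) auto
          moreover have "\<bar>X (dyadic_floor k t) \<omega>\<bar>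
            \<le> 2 / (1 - q) * (real (Suc n) powr (1 / p + \<epsilon> / 2) * (2 ^ n) powr H)" for k
            using elim dyadic_floor_in[of k t] dyadic_floor_bounds(2)[of t k] t by auto
          ultimately show "\<bar>Y t \<omega>\<bar> \<le> 2 / (1 - q) * (real (Suc n) powr (1 / p + \<epsilon> / 2) * (2 ^ n) powr H)"
            by (intro LIMSEQ_le_const2) auto
        qed
      qed
      from powr_log_growth_tendsto_zero[OF H_pos _ \<open>\<epsilon> / 2 > 0\<close> _ this]
      show ?case using q_bounds p_pos \<open>\<epsilon> > 0\<close> by (simp add: add.assoc)
    qed
  qed
  ultimately show ?thesis by (rule that)
qed

section \<open>Transfer to separable processes\<close>

text \<open>As \<open>D\<close> is countable, \<open>X\<close> and \<open>Y\<close> almost surely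
  agree on all of \<open>D\<close> at once. Each point of the graph of \<open>X\<close> is then a
  limit of points of the graph of \<open>Y\<close>, which is closed by continuity.\<close>

lemma separable_process_eq_continuous_modification:
  assumes "separable_process M X" "is_modification M X Y" "continuous_paths M Y"
  shows "AE \<omega> in M. \<forall>t\<ge>0. X t \<omega> = Y t \<omega>"
proof -
  obtain D where D: "countable D" "D \<subseteq> {0..}"
    and sep: "AE \<omega> in M. \<forall>t\<ge>0. (t, X t \<omega>) \<in> closure ((\<lambda>s. (s, X s \<omega>)) ` D)"
    using assms(1) unfolding separable_process_def by blast
  have "AE \<omega> in M. \<forall>s\<in>D. Y s \<omega> = X s \<omega>"
    using D assms(2) by (subst AE_ball_countable) (auto simp: is_modification_def)
  with sep AE_space show ?thesis
  proof eventually_elim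
    case (elim \<omega>)
    have cont: "continuous_on {0..} (\<lambda>t. Y t \<omega>)"
      using assms(3) elim(2) by (simp add: continuous_paths_def)
    show ?case
    proof (intro allI impI)
      fix t :: real assume t: "t \<ge> 0"
      then have "(t, X t \<omega>) \<in> closure ((\<lambda>s. (s, X s \<omega>)) ` D)" using elim(1) by blast
      then obtain u where u: "\<And>n. u n \<in> (\<lambda>s. (s, X s \<omega>)) ` D" "u \<longlonglongrightarrow> (t, X t \<omega>)"
        unfolding closure_sequential by blast
      have fst: "(\<lambda>n. fst (u n)) \<longlonglongrightarrow> t" and snd: "(\<lambda>n. snd (u n)) \<longlonglongrightarrow> X t \<omega>"
        using tendsto_fst[OF u(2)] tendsto_snd[OF u(2)] by auto
      have uD: "fst (u n) \<in> D" "snd (u n) = Y (fst (u n)) \<omega>" for n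
        using u(1)[of n] elim(3) by auto
      have "(\<lambda>n. Y (fst (u n)) \<omega>) \<longlonglongrightarrow> Y t \<omega>"
        by (rule continuous_on_tendsto_compose[OF cont fst]) (use t uD(1) D(2) in \<open>auto intro!: always_eventually\<close>)
      then show "X t \<omega> = Y t \<omega>"
        using snd LIMSEQ_unique by (auto simp: uD(2))
    qed
  qed
qed

theorem theorem2p2:
  fixes M :: "'a measure" and X :: "real \<Rightarrow> 'a \<Rightarrow> real" and H p :: real
  assumes "prob_space M"
    and "H > 0"
    and "SSSI M H X"
    and "p > max 1 (1 / H)"
    and "integrable M (\<lambda>\<omega>. \<bar>X 1 \<omega>\<bar> powr p)"
  shows "(separable_process M X \<longrightarrow>
            (\<forall>\<epsilon>>0. AE \<omega> in M.
               ((\<lambda>t. \<bar>X t \<omega>\<bar> / (t powr H * ln t powr (1 / p + \<epsilon>))) \<longlongrightarrow> 0) at_top)) \<and>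
         (\<exists>Y. is_modification M X Y \<and> continuous_paths M Y \<and>
            (\<forall>\<epsilon>>0. AE \<omega> in M.
               ((\<lambda>t. \<bar>Y t \<omega>\<bar> / (t powr H * ln t powr (1 / p + \<epsilon>))) \<longlongrightarrow> 0) at_top))"
proof -
  interpret prob_space M by fact
  have p: "p > 0" "1 / H < p" using assms(4) by auto
  interpret increment_tail M X H p "\<integral>\<omega>. \<bar>X 1 \<omega>\<bar> powr p \<partial>M"
  proof
    show "X t \<in> borel_measurable M" if "t \<ge> 0" for t
      using assms(3) that by (simp add: SSSI_def real_process_def)
    then show "AE \<omega> in M. X 0 \<omega> = 0"
      using assms(2,3) by (intro self_similar_zero) (auto simp: SSSI_def)
    show "H * p > 1" using p assms(2) by (simp add: field_simps)
  qed (use assms p in \<open>auto intro: SSSI_increment_tail\<close>)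
  obtain Y where Y: "is_modification M X Y" "continuous_paths M Y"
    and growth: "\<And>\<epsilon>. \<epsilon> > 0 \<Longrightarrow>
      AE \<omega> in M. ((\<lambda>t. \<bar>Y t \<omega>\<bar> / (t powr H * ln t powr (1 / p + \<epsilon>))) \<longlongrightarrow> 0) at_top"
    using ex_continuous_modification by blast
  have "AE \<omega> in M. ((\<lambda>t. \<bar>X t \<omega>\<bar> / (t powr H * ln t powr (1 / p + \<epsilon>))) \<longlongrightarrow> 0) at_top"
    if "separable_process M X" "\<epsilon> > 0" for \<epsilon>
    using separable_process_eq_continuous_modification[OF that(1) Y] growth[OF that(2)]
  proof eventually_elim
    case (elim \<omega>)
    \<comment> \<open>The paths agree for nonnegative times, hence eventually, which is enough for
      the limit.\<close>
    have "\<forall>\<^sub>F t in at_top. \<bar>Y t \<omega>\<bar> / (t powr H * ln t powr (1 / p + \<epsilon>)) =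
        \<bar>X t \<omega>\<bar> / (t powr H * ln t powr (1 / p + \<epsilon>))"
      using eventually_ge_at_top[of "0::real"] by eventually_elim (use elim(1) in auto)
    from tendsto_cong[OF this] show ?case using elim(2) by blast
  qed
  with Y growth show ?thesis by blast
qed

end
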